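(* Let $A$ and $B$ be two disjoint sets of integers, with $|A| = m$ and $|B| = n$. For each $u \in \mathfrak{S}_A$ and $v \in \mathfrak{S}_B$, the distribution of cyclic descent number over all cyclic shuffles of $[u]$ and $[v]$ is given by \[ \sum_{[w] \in [u] \,\sqcup\!\sqcup_{\mathrm{cyc}}\, [v]} q^{\mathrm{cdes}(w)} = (1-q)^{m+n} \sum_r \binom{r+m-\mathrm{cdes}(u)-1}{m-1} \binom{r+n-\mathrm{cdes}(v)-1}{n-1} r q^r. \]
   Context: For a finite set $A$ of size $a$, $\mathfrak{S}_A$ is the set of bijections $u:[a]\to A$, viewed as words $u=(u_1,\ldots,u_a)$. For a set of integers $A$ and $u\in\mathfrak{S}_A$, the cyclic descent set is $\mathrm{cDes}(u):=\{1\le i\le a : u_i>u_{i+1}\}$ with $u_{a+1}:=u_1$, and $\mathrm{cdes}(u):=|\mathrm{cDes}(u)|$, which depends only on the cyclic class $[u]$ of $u$ under cyclic rotations. For disjoint $A,B$, a cyclic shuffle of $[u]$ and $[v]$ is a class $[w]$, $w\in\mathfrak{S}_{A\sqcup B}$, having a representative that is a shuffle (contains both as subwords) of some cyclic shift of $u$ and some cyclic shift of $v$; $[u]\,\sqcup\!\sqcup_{\mathrm{cyc}}\,[v]$ denotes the set of all such cyclic shuffles. *)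

theory Defs
  imports
    "HOL-Combinatorics.Multiset_Permutations"
    "HOL-Computational_Algebra.Formal_Power_Series"
begin

text \<open>
  Words in \<open>\<SS>\<^sub>A\<close> are the elements of \<^const>\<open>permutations_of_set\<close> \<open>A\<close>, and shuffles of words
  are \<^const>\<open>shuffles\<close>.  Positions are counted from 1, so the letter \<open>u\<^sub>i\<close> is \<open>u ! (i - 1)\<close>;
  taking \<open>u\<^sub>i\<^sub>+\<^sub>1\<close> as \<open>u ! (i mod length u)\<close> encodes the convention \<open>u\<^sub>a\<^sub>+\<^sub>1 = u\<^sub>1\<close>.
\<close>

definition cDes :: "int list \<Rightarrow> nat set" where
  "cDes u = {i. 1 \<le> i \<and> i \<le> length u \<and> u ! (i - 1) > u ! (i mod length u)}"

definition cdes :: "int list \<Rightarrow> nat" where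
  "cdes u = card (cDes u)"

definition cyc_class :: "'a list \<Rightarrow> 'a list set" where
  "cyc_class u = {rotate k u | k. True}"

text \<open>The cyclic descent number of a class, i.e. the common value of \<^const>\<open>cdes\<close> on its
  elements; see \<open>cdes_class_cyc_class\<close> below.\<close>

definition cdes_class :: "int list set \<Rightarrow> nat" where
  "cdes_class C = the_elem (cdes ` C)"

definition cyc_shuffles :: "'a list set \<Rightarrow> 'a list set \<Rightarrow> 'a list set set" where
  "cyc_shuffles U V = {cyc_class w | w. \<exists>u\<in>U. \<exists>v\<in>V. w \<in> shuffles u v}"

lemma cdes_conv_sum:
  "cdes u = (\<Sum>j<length u. if u ! j > u ! (Suc j mod length u) then 1 else 0)"
proof -
  have "cDes u = Suc ` {j. j < length u \<and> u ! j > u ! (Suc j mod length u)}"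
    (is "_ = Suc ` ?D")
  proof (intro equalityI subsetI)
    fix i assume "i \<in> cDes u"
    then show "i \<in> Suc ` ?D"
      by (cases i) (auto simp: cDes_def)
  qed (auto simp: cDes_def)
  then have "cdes u = card ?D"
    by (simp add: cdes_def card_image)
  also have "?D = {j \<in> {..<length u}. u ! j > u ! (Suc j mod length u)}"
    by auto
  also have "card \<dots> = (\<Sum>j<length u. if u ! j > u ! (Suc j mod length u) then 1 else 0)"
    by (simp add: sum.If_cases Int_def)
  finally show ?thesis .
qed

lemma cdes_rotate1: "cdes (rotate1 u) = cdes u"
proof -
  define a where "a = length u"
  define f :: "nat \<Rightarrow> nat" where
    "f j = (if u ! (j mod a) > u ! (Suc j mod a) then 1 else 0)" for j
  have "cdes (rotate1 u) = (\<Sum>j<a. f (Suc j))"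
    unfolding cdes_conv_sum length_rotate1 a_def[symmetric]
  proof (rule sum.cong[OF refl])
    fix j assume j: "j \<in> {..<a}"
    then have "Suc j mod a < a" by auto
    with j show "(if rotate1 u ! j > rotate1 u ! (Suc j mod a) then 1 else 0) = f (Suc j)"
      by (simp add: f_def nth_rotate1 a_def mod_Suc_eq)
  qed
  moreover have "cdes u = (\<Sum>j<a. f j)"
    unfolding cdes_conv_sum a_def[symmetric]
    by (rule sum.cong) (auto simp: f_def)
  moreover have "f 0 + (\<Sum>j<a. f (Suc j)) = (\<Sum>j<a. f j) + f a"
    using sum.lessThan_Suc_shift[of f a] by simp
  moreover have "f a = f 0"
    using mod_add_self2[of "Suc 0" a] by (simp add: f_def)
  ultimately show ?thesis by simp
qed

lemma cdes_rotate: "cdes (rotate k u) = cdes u"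
  by (induction k) (simp_all add: cdes_rotate1)

lemma cdes_class_cyc_class: "cdes_class (cyc_class w) = cdes w"
proof -
  have "cyc_class w = range (\<lambda>k. rotate k w)"
    unfolding cyc_class_def full_SetCompr_eq[symmetric] by simp
  then have "cdes ` cyc_class w = {cdes w}"
    by (simp add: image_image cdes_rotate)
  then show ?thesis by (simp add: cdes_class_def)
qed

lemma cyc_class_shuffle_permutations:
  assumes "u \<in> permutations_of_set A" "v \<in> permutations_of_set B" "A \<inter> B = {}"
    and "u' \<in> cyc_class u" "v' \<in> cyc_class v" "w \<in> shuffles u' v'"
  shows "w \<in> permutations_of_set (A \<union> B)"
proof -
  have "set u' = A" "distinct u'" "set v' = B" "distinct v'"
    using assms by (auto simp: permutations_of_set_def cyc_class_def)
  then show ?thesis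
    using assms distinct_disjoint_shuffles[of u' v' w] set_shuffles[of w u' v']
    by (auto simp: permutations_of_set_def)
qed

lemma finite_cyc_shuffles:
  assumes "u \<in> permutations_of_set A" "v \<in> permutations_of_set B" "A \<inter> B = {}"
  shows "finite (cyc_shuffles (cyc_class u) (cyc_class v))"
proof -
  have "finite (A \<union> B)"
    using assms by (auto simp: permutations_of_set_def)
  moreover have "cyc_shuffles (cyc_class u) (cyc_class v) \<subseteq> cyc_class ` permutations_of_set (A \<union> B)"
    using cyc_class_shuffle_permutations[OF assms] by (fastforce simp: cyc_shuffles_def)
  ultimately show ?thesis
    by (meson finite_imageI finite_permutations_of_set finite_subset)
qed

text \<open>Consequently the subtraction \<open>r + m - cdes u - 1\<close> on natural numbers never truncates
  when \<open>m = length u\<close> is positive.\<close>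

lemma cdes_less_length:
  assumes "u \<noteq> []"
  shows "cdes u < length u"
proof -
  obtain j where j: "j < length u" "u ! j = Min (set u)"
    by (metis Min_in List.finite_set assms in_set_conv_nth set_empty)
  have "u ! j \<le> u ! (Suc j mod length u)"
    using j assms by simp
  then have "Suc j \<notin> cDes u"
    by (simp add: cDes_def)
  moreover have "Suc j \<in> {1..length u}"
    using j by simp
  moreover have "cDes u \<subseteq> {1..length u}"
    by (auto simp: cDes_def)
  ultimately have "cDes u \<subset> {1..length u}"
    by blast
  then show ?thesis
    using psubset_card_mono[of "{1..length u}" "cDes u"] by (simp add: cdes_def)
qed

end

theory Submission
  imports Defs "HOL-Library.Product_Lexorder"
begin

text \<open>
  Since the statement is symmetric, the maximum \<open>p\<close> of all letters may be taken to lie in \<open>u\<close>, and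
  after a rotation \<open>u = p # t\<close>.  Every cyclic shuffle then has a unique representative \<open>p # w\<close>, where
  \<open>w\<close> is a linear shuffle of \<open>t\<close> with one of the \<open>n\<close> rotations of \<open>v\<close>; as \<open>p\<close> is maximal, the cyclic
  descent number of \<open>p # w\<close> is one more than the descent number of \<open>w\<close>.  Stanley's shuffling theorem
  for linear words evaluates the sum for each rotation.  Exactly \<open>c = cdes v\<close> of the rotations of \<open>v\<close>
  have \<open>c - 1\<close> descents and the other \<open>n - c\<close> have \<open>c\<close>, so adding up the rotations is a binomial
  identity.

  Stanley's theorem is proved with \<open>P\<close>-partitions: a map \<open>f\<close> on the letters is compatible with a word
  if it increases weakly along the word, and strictly at descents, i.e. if the pairs \<open>(f x, x)\<close>
  increase lexicographically.
\<close>

section \<open>Linear descents compared with cyclic descents\<close>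

primrec des :: "'a::linorder list \<Rightarrow> nat" where
  "des [] = 0"
| "des (x # w) = of_bool (w \<noteq> [] \<and> x > hd w) + des w"

lemma des_snoc: "des (w @ [x]) = des w + of_bool (w \<noteq> [] \<and> last w > x)"
  by (induction w) (auto simp: hd_append)

lemma des_le: "des w \<le> length w - 1"
proof (induction w)
  case (Cons x w)
  then show ?case by (cases w) auto
qed simp

lemma des_Cons_conv_sum: "des (x # w) = (\<Sum>j<length w. of_bool ((x # w) ! j > w ! j))"
proof (induction w arbitrary: x)
  case (Cons y w)
  show ?case
    using Cons[of y] by (simp add: sum.lessThan_Suc_shift del: sum.lessThan_Suc)
qed simp

lemma cdes_conv_des:
  assumes "w \<noteq> []"
  shows "cdes w = des w + of_bool (last w > hd w)"
proof -
  obtain x t where w: "w = x # t" using assms by (cases w) auto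
  have "cdes w = (\<Sum>j<length t. of_bool (w ! j > w ! Suc j)) + of_bool (w ! length t > x)"
    unfolding cdes_conv_sum by (simp add: w of_bool_def)
  then show ?thesis
    by (simp add: w des_Cons_conv_sum last_conv_nth del: des.simps)
qed

text \<open>Each cyclically adjacent pair of positions of \<open>v\<close> becomes the wrap-around
  pair of exactly one rotation.\<close>

lemma sum_rotate_last_gt_hd:
  assumes "v \<noteq> []"
  shows "(\<Sum>k<length v. of_bool (last (rotate k v) > hd (rotate k v))) = cdes v"
proof -
  obtain N where N: "length v = Suc N" using assms by (cases v) auto
  define f :: "nat \<Rightarrow> nat" where
    "f j = of_bool (v ! (j mod Suc N) > v ! (Suc j mod Suc N))" for j
  \<comment> \<open>The last letter of \<open>rotate k v\<close> sits at index \<open>k - 1\<close>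
    modulo \<open>Suc N\<close>, written \<open>k + N\<close> to avoid subtraction.\<close>
  have "last (rotate k v) > hd (rotate k v) \<longleftrightarrow>
      v ! ((k + N) mod Suc N) > v ! (Suc (k + N) mod Suc N)" for k
    using assms N mod_add_self2[of k "Suc N"]
    by (simp add: last_conv_nth hd_conv_nth nth_rotate del: mod_add_self2)
  then have "(\<Sum>k<length v. of_bool (last (rotate k v) > hd (rotate k v))) = (\<Sum>k<Suc N. f (k + N))"
    by (simp only: N f_def)
  also have "\<dots> = f N + (\<Sum>k<N. f (k + Suc N))"
    by (simp only: sum.lessThan_Suc_shift) simp
  also have "(\<Sum>k<N. f (k + Suc N)) = (\<Sum>k<N. f k)"
  proof (rule sum.cong[OF refl])
    fix k
    show "f (k + Suc N) = f k"
      using mod_add_self2[of k "Suc N"] mod_add_self2[of "Suc k" "Suc N"] by (simp add: f_def)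
  qed
  also have "f N + (\<Sum>k<N. f k) = cdes v"
    unfolding cdes_conv_sum N by (simp add: f_def of_bool_def)
  finally show ?thesis .
qed

section \<open>Bounded P-partitions of a word and their number\<close>

text \<open>The bound \<open>r\<close> and extensionality make the set finite, and a map is
  determined by its values on the letters.\<close>

definition compat_maps :: "nat \<Rightarrow> 'a::linorder list \<Rightarrow> ('a \<Rightarrow> nat) set" where
  "compat_maps r w =
    {f \<in> set w \<rightarrow>\<^sub>E {..<r}. sorted_wrt (<) (map (\<lambda>x. (f x, x)) w)}"

lemma sorted_wrt_map_cong:
  assumes "\<And>x. x \<in> set w \<Longrightarrow> f x = g x"
  shows "sorted_wrt P (map f w) \<longleftrightarrow> sorted_wrt P (map g w)"
  using assms by (metis map_cong)

lemma finite_compat_maps: "finite (compat_maps r w)"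
  unfolding compat_maps_def by (rule finite_subset[of _ "set w \<rightarrow>\<^sub>E {..<r}"]) (auto intro: finite_PiE)

text \<open>The value \<open>j\<close> at the last letter bounds all earlier ones: strictly if the
  last step is a descent, weakly (hence \<open>Suc j\<close>) otherwise.\<close>

lemma compat_maps_snoc:
  assumes "distinct (w @ [x])"
  shows "compat_maps r (w @ [x]) = (\<lambda>(j, g). g(x := j)) `
    (SIGMA j:{..<r}. compat_maps (if w \<noteq> [] \<and> last w > x then j else Suc j) w)"
    (is "_ = ?h ` ?S")
proof -
  let ?k = "\<lambda>f x. (f x :: nat, x)"
  have x: "x \<notin> set w" using assms by simp
  have sorted_upd: "sorted_wrt (<) (map (?k (g(x := j))) w) \<longleftrightarrow> sorted_wrt (<) (map (?k g) w)" for g j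
    by (rule sorted_wrt_map_cong) (use x in auto)
  have snoc: "sorted_wrt (<) (map (?k (g(x := j))) (w @ [x])) \<and> (\<forall>y\<in>set w. g y < r) \<longleftrightarrow>
      sorted_wrt (<) (map (?k g) w) \<and>
      (\<forall>y\<in>set w. g y < (if w \<noteq> [] \<and> last w > x then j else Suc j))"
    if "j < r" for g j
  proof -
    \<comment> \<open>In a sorted word the last letter \<open>z\<close> of \<open>w\<close> has the
      largest key, so only \<open>z\<close> has to be compared with \<open>x\<close>.\<close>
    have bound: "(\<forall>y\<in>set w. (g y, y) < (j, x)) \<longleftrightarrow>
        (\<forall>y\<in>set w. g y < (if w \<noteq> [] \<and> last w > x then j else Suc j))"
      if sorted: "sorted_wrt (<) (map (?k g) w)"
    proof (cases w rule: rev_cases)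
      case (snoc t z)
      have "z \<noteq> x" using x snoc by auto
      have zw: "z \<in> set w" by (simp add: snoc)
      have le: "(g y, y) \<le> (g z, z)" if "y \<in> set w" for y
        using sorted that by (auto simp: snoc sorted_wrt_append)
      have "(\<forall>y\<in>set w. (g y, y) < (j, x)) \<longleftrightarrow> (g z, z) < (j, x)"
        by (meson le le_less_trans zw)
      also have "\<dots> \<longleftrightarrow> g z < (if z > x then j else Suc j)"
        using \<open>z \<noteq> x\<close> by auto
      also have "\<dots> \<longleftrightarrow> (\<forall>y\<in>set w. g y < (if z > x then j else Suc j))"
        using le by (fastforce simp: snoc)
      finally show ?thesis by (simp add: snoc)
    qed simp
    have lt: "\<forall>y\<in>set w. g y < r" if "\<forall>y\<in>set w. (g y, y) < (j, x)"
      using that \<open>j < r\<close> by force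
    have "sorted_wrt (<) (map (?k (g(x := j))) (w @ [x])) \<longleftrightarrow>
        sorted_wrt (<) (map (?k g) w) \<and> (\<forall>y\<in>set w. (g y, y) < (j, x))"
      unfolding map_append sorted_wrt_append sorted_upd
      using x by (simp del: less_prod_simp cong: ball_cong_simp) (metis fun_upd_other)
    then show ?thesis using bound lt by blast
  qed
  show ?thesis
  proof (intro equalityI subsetI)
    fix f assume f: "f \<in> compat_maps r (w @ [x])"
    then have "f \<in> insert x (set w) \<rightarrow>\<^sub>E {..<r}" by (simp add: compat_maps_def)
    then obtain j g where jg: "j < r" "g \<in> set w \<rightarrow>\<^sub>E {..<r}" "f = g(x := j)"
      unfolding PiE_insert_eq by auto
    have "sorted_wrt (<) (map (?k (g(x := j))) (w @ [x]))"
      using f by (simp add: compat_maps_def jg(3))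
    moreover have "\<forall>y\<in>set w. g y < r" using jg(2) by auto
    ultimately have "g \<in> compat_maps (if w \<noteq> [] \<and> last w > x then j else Suc j) w"
      using snoc[OF jg(1), of g] jg(2) by (auto simp: compat_maps_def PiE_iff)
    then show "f \<in> ?h ` ?S" using jg by (auto intro!: image_eqI[of _ _ "(j, g)"])
  next
    fix f assume "f \<in> ?h ` ?S"
    then obtain j g where jg: "j < r" "f = g(x := j)"
      "g \<in> compat_maps (if w \<noteq> [] \<and> last w > x then j else Suc j) w" by auto
    have *: "sorted_wrt (<) (map (?k (g(x := j))) (w @ [x])) \<and> (\<forall>y\<in>set w. g y < r)"
      unfolding snoc[OF jg(1)] using jg(3) by (auto simp: compat_maps_def PiE_iff split: if_splits)
    moreover have "g \<in> set w \<rightarrow>\<^sub>E {..<r}"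
      using * jg(3) by (auto simp: compat_maps_def PiE_iff)
    then have "f \<in> insert x (set w) \<rightarrow>\<^sub>E {..<r}"
      unfolding PiE_insert_eq jg(2) using jg(1) by (auto intro!: image_eqI[of _ _ "(j, g)"])
    ultimately show "f \<in> compat_maps r (w @ [x])"
      by (simp add: compat_maps_def jg(2))
  qed
qed

text \<open>The hypothesis makes \<open>M choose Suc N\<close> vanish, which is the case
  \<open>r = 0\<close>.\<close>

lemma sum_choose_hockey_stick:
  assumes "M \<le> N"
  shows "(\<Sum>j<r. (j + M) choose N) = (r + M) choose Suc N"
  using assms by (induction r) (auto simp: binomial_eq_0)

text \<open>Removing the last letter leaves a sum over its value, evaluated by the hockey-stick
  identity.\<close>

lemma card_compat_maps:
  assumes "distinct w"
  shows "card (compat_maps r w) = (r + length w - 1 - des w) choose length w"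
  using assms
proof (induction w arbitrary: r rule: rev_induct)
  case Nil
  show ?case by (simp add: compat_maps_def)
next
  case (snoc x w)
  let ?d = "w \<noteq> [] \<and> last w > x"
  let ?S = "SIGMA j:{..<r}. compat_maps (if ?d then j else Suc j) w"
  \<comment> \<open>Each \<open>g\<close> is \<open>undefined\<close> at \<open>x\<close>, so
    \<open>g(x := j)\<close> determines both \<open>j\<close> and \<open>g\<close>.\<close>
  have "inj_on (\<lambda>(j, g). g(x := j)) ?S"
    by (rule inj_on_subset[OF inj_combinator[of x "set w" "\<lambda>_. UNIV"]])
      (use snoc.prems in \<open>auto simp: compat_maps_def PiE_def\<close>)
  then have "card (compat_maps r (w @ [x])) = card ?S"
    using compat_maps_snoc[OF snoc.prems] by (simp add: card_image)
  also have "\<dots> = (\<Sum>j<r. card (compat_maps (if ?d then j else Suc j) w))"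
    by (simp add: finite_compat_maps)
  \<comment> \<open>A final descent lowers the bound by one and raises \<open>des\<close> by one, so
    both cases give the same binomial coefficient.\<close>
  also have "\<dots> = (\<Sum>j<r. (j + (length w - des (w @ [x]))) choose length w)"
  proof (rule sum.cong[OF refl])
    fix j
    have "w = [] \<or> des w < length w" using des_le[of w] by (cases w) auto
    then show "card (compat_maps (if ?d then j else Suc j) w)
        = (j + (length w - des (w @ [x]))) choose length w"
      using snoc by (auto simp: des_snoc intro!: arg_cong2[of _ _ _ _ binomial])
  qed
  also have "\<dots> = (r + (length w - des (w @ [x]))) choose Suc (length w)"
    by (rule sum_choose_hockey_stick) simp
  finally show ?case using des_le[of "w @ [x]"] by simp
qed

section \<open>Compatible maps of shuffles\<close>

lemma in_shuffles_filterI: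
  assumes "set w = set u \<union> set v" "set u \<inter> set v = {}"
    and "filter (\<lambda>x. x \<in> set u) w = u" "filter (\<lambda>x. x \<in> set v) w = v"
  shows "w \<in> shuffles u v"
proof -
  have "filter (\<lambda>x. x \<notin> set u) w = filter (\<lambda>x. x \<in> set v) w"
    by (rule filter_cong) (use assms in auto)
  then show ?thesis
    using partition_in_shuffles[of w "\<lambda>x. x \<in> set u"] assms by simp
qed

text \<open>The letter is part of its key, so ties of \<open>f\<close> are broken and
  \<open>f\<close> determines the word.\<close>

lemma sorted_keys_unique:
  fixes f :: "'a::linorder \<Rightarrow> nat"
  assumes "sorted_wrt (<) (map (\<lambda>x. (f x, x)) v)" "sorted_wrt (<) (map (\<lambda>x. (f x, x)) w)"
    and "set v = set w"
  shows "v = w"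
proof -
  have "map (\<lambda>x. (f x, x)) v = map (\<lambda>x. (f x, x)) w"
    by (rule strict_sorted_equal) (use assms in auto)
  from arg_cong[OF this, of "map snd"] show ?thesis by (simp add: comp_def)
qed

lemma sorted_keys_exists:
  fixes f :: "'a::linorder \<Rightarrow> nat"
  assumes "finite S"
  obtains w where "set w = S" "sorted_wrt (<) (map (\<lambda>x. (f x, x)) w)"
proof
  define xs where "xs = sorted_list_of_set ((\<lambda>x. (f x, x)) ` S)"
  have set: "set xs = (\<lambda>x. (f x, x)) ` S" by (simp add: xs_def assms)
  show "set (map snd xs) = S" by (simp add: set image_image)
  have "map (\<lambda>x. (f x, x)) (map snd xs) = xs"
    unfolding map_map by (rule map_idI) (auto simp: set)
  then show "sorted_wrt (<) (map (\<lambda>x. (f x, x)) (map snd xs))" by (simp add: xs_def)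
qed

lemma sorted_keys_filter:
  assumes "sorted_wrt (<) (map f w)"
  shows "sorted_wrt (<) (map f (filter P w))"
  using assms by (simp add: sorted_wrt_map sorted_wrt_filter)

lemma sorted_keys_restrict:
  assumes "set u \<subseteq> S"
  shows "sorted_wrt (<) (map (\<lambda>x. (restrict f S x, x)) u) \<longleftrightarrow>
    sorted_wrt (<) (map (\<lambda>x. (f x, x)) u)"
  by (rule sorted_wrt_map_cong) (use assms in auto)

text \<open>Every map on the union of the letters is compatible with exactly one word, and the two
  subwords of that word are the ones with which the restrictions are compatible.\<close>

lemma bij_betw_compat_maps_shuffles:
  fixes u v :: "'a::linorder list"
  assumes uv: "set u \<inter> set v = {}"
  shows "bij_betw (\<lambda>f. (restrict f (set u), restrict f (set v)))
    (\<Union>w\<in>shuffles u v. compat_maps r w) (compat_maps r u \<times> compat_maps r v)"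
    (is "bij_betw ?h ?S ?T")
proof (rule bij_betw_imageI)
  show "inj_on ?h ?S"
  proof (rule inj_onI)
    fix f g assume f: "f \<in> ?S" and g: "g \<in> ?S" and fg: "?h f = ?h g"
    have "f \<in> extensional (set u \<union> set v)" "g \<in> extensional (set u \<union> set v)"
      using f g by (auto simp: compat_maps_def PiE_def set_shuffles)
    moreover have "f x = g x" if "x \<in> set u \<union> set v" for x
      using fg that by (metis Pair_inject Un_iff restrict_apply')
    ultimately show "f = g" by (rule extensionalityI)
  qed
  show "?h ` ?S = ?T"
  proof (intro equalityI subsetI)
    fix p assume "p \<in> ?h ` ?S"
    then obtain f w where w: "w \<in> shuffles u v" "f \<in> compat_maps r w" and p: "p = ?h f"
      by blast
    have "sorted_wrt (<) (map (\<lambda>x. (f x, x)) w)" using w(2) by (simp add: compat_maps_def)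
    from sorted_keys_filter[OF this, of "\<lambda>x. x \<in> set u"]
      sorted_keys_filter[OF this, of "\<lambda>x. x \<in> set v"]
    show "p \<in> ?T"
      using w set_shuffles[OF w(1)] filter_shuffles_disjoint1(1)[OF uv w(1)]
        filter_shuffles_disjoint2(1)[OF uv w(1)]
      by (auto simp: p compat_maps_def sorted_keys_restrict simp del: restrict_apply)
  next
    fix p assume "p \<in> ?T"
    then obtain g h where p: "p = (g, h)" and g: "g \<in> compat_maps r u" and h: "h \<in> compat_maps r v"
      by blast
    define f where "f = restrict (\<lambda>x. if x \<in> set u then g x else h x) (set u \<union> set v)"
    have fg: "restrict f (set u) = g" and fh: "restrict f (set v) = h"
      using g h uv unfolding compat_maps_def f_def
      by (auto simp: fun_eq_iff PiE_def extensional_def)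
    \<comment> \<open>Sorting the letters by the keys of the glued map \<open>f\<close> gives the
      shuffle; its two subwords are sorted by the keys of \<open>g\<close> and \<open>h\<close>, so
      by uniqueness they are \<open>u\<close> and \<open>v\<close>.\<close>
    obtain w where w: "set w = set u \<union> set v" "sorted_wrt (<) (map (\<lambda>x. (f x, x)) w)"
      using sorted_keys_exists[of "set u \<union> set v" f] by auto
    have "filter (\<lambda>x. x \<in> set u) w = u"
    proof (rule sorted_keys_unique)
      show "sorted_wrt (<) (map (\<lambda>x. (f x, x)) u)"
        using g by (subst sorted_keys_restrict[symmetric, OF subset_refl]) (simp add: fg compat_maps_def)
    qed (use w sorted_keys_filter in auto)
    moreover have "filter (\<lambda>x. x \<in> set v) w = v"
    proof (rule sorted_keys_unique)
      show "sorted_wrt (<) (map (\<lambda>x. (f x, x)) v)"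
        using h by (subst sorted_keys_restrict[symmetric, OF subset_refl]) (simp add: fh compat_maps_def)
    qed (use w sorted_keys_filter in auto)
    ultimately have "w \<in> shuffles u v"
      using w(1) uv by (intro in_shuffles_filterI)
    moreover have "f \<in> compat_maps r w"
      using w g h unfolding compat_maps_def f_def by (auto simp: PiE_iff)
    ultimately show "p \<in> ?h ` ?S"
      using p fg fh by (intro image_eqI[of _ _ f]) auto
  qed
qed

text \<open>All shuffles have the same letters, so no map is compatible with two of them; the sum
  counts a disjoint union, which restriction maps bijectively onto a product.\<close>

lemma sum_card_compat_maps_shuffles:
  fixes u v :: "'a::linorder list"
  assumes "set u \<inter> set v = {}"
  shows "(\<Sum>w\<in>shuffles u v. card (compat_maps r w)) = card (compat_maps r u) * card (compat_maps r v)"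
proof -
  have "(\<Sum>w\<in>shuffles u v. card (compat_maps r w)) = card (\<Union>w\<in>shuffles u v. compat_maps r w)"
  proof (rule card_UN_disjoint[symmetric])
    show "\<forall>w\<in>shuffles u v. \<forall>w'\<in>shuffles u v. w \<noteq> w' \<longrightarrow> compat_maps r w \<inter> compat_maps r w' = {}"
    proof (intro ballI impI)
      fix w w' assume w: "w \<in> shuffles u v" "w' \<in> shuffles u v" "w \<noteq> w'"
      then have "set w = set w'" by (simp add: set_shuffles)
      then show "compat_maps r w \<inter> compat_maps r w' = {}"
        using sorted_keys_unique w(3) unfolding compat_maps_def by blast
    qed
  qed (auto simp: finite_compat_maps)
  then show ?thesis
    using bij_betw_same_card[OF bij_betw_compat_maps_shuffles[OF assms]]
    by (simp add: card_cartesian_product)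
qed

section \<open>Generating functions and Stanley's shuffling theorem\<close>

lemma fps_X_mult_Abs_fps:
  "(fps_X :: 'a::comm_ring_1 fps) * Abs_fps f = Abs_fps (\<lambda>r. if r = 0 then 0 else f (r - 1))"
  by (simp add: fps_eq_iff)

lemma one_minus_fps_X_mult_Abs_fps:
  "(1 - fps_X :: 'a::comm_ring_1 fps) * Abs_fps f =
    Abs_fps (\<lambda>r. f r - (if r = 0 then 0 else f (r - 1)))"
  by (simp add: fps_eq_iff left_diff_distrib)

text \<open>Multiplication by \<open>1 - fps_X\<close> takes differences of coefficients, and
  Pascal's rule computes these.\<close>

lemma one_minus_fps_X_power_mult_choose:
  "(1 - fps_X :: 'a::comm_ring_1 fps) ^ Suc d * Abs_fps (\<lambda>r. of_nat (r choose d)) = fps_X ^ d"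
proof (induction d)
  case 0
  show ?case by (auto simp: one_minus_fps_X_mult_Abs_fps fps_eq_iff)
next
  case (Suc d)
  have shift: "(1 - fps_X :: 'a fps) * Abs_fps (\<lambda>r. of_nat (r choose Suc d)) =
      fps_X * Abs_fps (\<lambda>r. of_nat (r choose d))"
    unfolding one_minus_fps_X_mult_Abs_fps fps_X_mult_Abs_fps
    by (auto simp: fps_eq_iff gr0_conv_Suc)
  show ?case
    unfolding power_Suc2[of _ "Suc d"] mult.assoc shift mult.left_commute[of _ fps_X] Suc.IH
    by simp
qed

text \<open>Each factor \<open>1 - fps_X\<close> lowers \<open>M\<close> by Pascal's rule. With
  \<open>d = des w\<close> this recovers \<open>fps_X ^ des w\<close> from the numbers of compatible
  maps.\<close>

lemma one_minus_fps_X_power_mult_choose_shift: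
  "(1 - fps_X :: 'a::comm_ring_1 fps) ^ Suc (d + M) * Abs_fps (\<lambda>r. of_nat ((r + M) choose (d + M))) = fps_X ^ d"
proof (induction M)
  case 0
  show ?case using one_minus_fps_X_power_mult_choose by simp
next
  case (Suc M)
  have "(1 - fps_X :: 'a fps) * Abs_fps (\<lambda>r. of_nat ((r + Suc M) choose (d + Suc M))) =
      Abs_fps (\<lambda>r. of_nat ((r + M) choose (d + M)))"
    unfolding one_minus_fps_X_mult_Abs_fps
    \<comment> \<open>At \<open>r = 0\<close> there is no previous coefficient to subtract; both
      sides are 1 if \<open>d = 0\<close> and 0 otherwise.\<close>
    by (cases d) (auto simp: fps_eq_iff gr0_conv_Suc binomial_eq_0)
  then show ?case
    using Suc by (simp add: power_Suc2[of _ "Suc (d + M)"] mult.assoc del: power_Suc)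
qed

text \<open>All shuffles have the same length, so the power of \<open>1 - fps_X\<close> factors out
  and the numbers of compatible maps add up to a product. The bound \<open>Suc r\<close> allows the
  values from 0 to \<open>r\<close>.\<close>

lemma Stanley_shuffling:
  fixes u v :: "'a::linorder list"
  assumes "distinct u" "distinct v" "set u \<inter> set v = {}"
  shows "(\<Sum>w\<in>shuffles u v. fps_X ^ des w :: 'b::comm_ring_1 fps) =
    (1 - fps_X) ^ Suc (length u + length v) *
      Abs_fps (\<lambda>r. of_nat (((r + length u - des u) choose length u) *
                           ((r + length v - des v) choose length v)))"
proof -
  let ?N = "length u + length v"
  have each: "fps_X ^ des w = (1 - fps_X :: 'b fps) ^ Suc ?N * Abs_fps (\<lambda>r. of_nat (card (compat_maps (Suc r) w)))"
    if w: "w \<in> shuffles u v" for w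
  proof -
    have len: "length w = ?N" and dist: "distinct w"
      using w assms length_shuffles distinct_disjoint_shuffles by blast+
    have le: "des w \<le> ?N" using des_le[of w] len by simp
    then have "card (compat_maps (Suc r) w) = (r + (?N - des w)) choose (des w + (?N - des w))" for r
      by (simp add: card_compat_maps dist len)
    then show ?thesis
      using one_minus_fps_X_power_mult_choose_shift[of "des w" "?N - des w", where ?'a = 'b] le by simp
  qed
  have "(\<Sum>w\<in>shuffles u v. fps_X ^ des w :: 'b fps) =
      (1 - fps_X) ^ Suc ?N * (\<Sum>w\<in>shuffles u v. Abs_fps (\<lambda>r. of_nat (card (compat_maps (Suc r) w))))"
    unfolding sum_distrib_left by (rule sum.cong[OF refl each])
  also have "(\<Sum>w\<in>shuffles u v. Abs_fps (\<lambda>r. of_nat (card (compat_maps (Suc r) w)) :: 'b)) =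
      Abs_fps (\<lambda>r. of_nat (card (compat_maps (Suc r) u) * card (compat_maps (Suc r) v)))"
    by (simp add: fps_eq_iff fps_sum_nth sum_card_compat_maps_shuffles[OF assms(3), symmetric])
  finally show ?thesis
    by (simp add: card_compat_maps assms)
qed

section \<open>Cyclic classes and rotations\<close>

lemma cyc_class_eq_iff: "cyc_class v = cyc_class w \<longleftrightarrow> v \<in> cyc_class w"
proof
  show "v \<in> cyc_class w" if "cyc_class v = cyc_class w"
    using that by (metis (mono_tags, lifting) cyc_class_def mem_Collect_eq rotate0 id_apply)
  assume "v \<in> cyc_class w"
  then obtain k where v: "v = rotate k w" by (auto simp: cyc_class_def)
  \<comment> \<open>Rotating by \<open>k\<close> and then by \<open>k'\<close> amounts to a whole
    number of turns.\<close>
  define k' where "k' = length w - k mod length w"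
  have w: "w = rotate k' v"
  proof (cases "w = []")
    case False
    then have "k' + k mod length w = length w" by (simp add: k'_def)
    then have "rotate k' (rotate (k mod length w) w) = w" by (simp add: rotate_rotate)
    then show ?thesis by (simp add: v rotate_conv_mod[of k w])
  qed (simp add: v)
  have "rotate j v \<in> cyc_class w" for j unfolding v cyc_class_def by (auto simp: rotate_rotate)
  moreover have "rotate j w \<in> cyc_class v" for j
    by (subst w) (auto simp: cyc_class_def rotate_rotate)
  ultimately show "cyc_class v = cyc_class w" by (auto simp: cyc_class_def)
qed

lemma cyc_class_self: "w \<in> cyc_class w"
  by (simp flip: cyc_class_eq_iff)

lemma cyc_class_trans: "u \<in> cyc_class v \<Longrightarrow> v \<in> cyc_class w \<Longrightarrow> u \<in> cyc_class w"
  by (simp flip: cyc_class_eq_iff)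

lemma distinct_cyc_class: "v \<in> cyc_class w \<Longrightarrow> distinct v \<longleftrightarrow> distinct w"
  by (auto simp: cyc_class_def)

lemma rotate_append_in_cyc_class: "ys @ xs \<in> cyc_class (xs @ ys)"
  using rotate_append[of xs ys] unfolding cyc_class_def by (metis (mono_tags) mem_Collect_eq)

lemma in_cyc_classE:
  assumes "v \<in> cyc_class w"
  obtains xs ys where "w = xs @ ys" "v = ys @ xs"
proof -
  obtain k where "v = rotate k w" using assms by (auto simp: cyc_class_def)
  then show thesis
    using that[of "take (k mod length w) w" "drop (k mod length w) w"] by (simp add: rotate_drop_take)
qed

text \<open>The letter \<open>p\<close> occurs only once, so a rotation that keeps it in front is
  trivial.\<close>

lemma cyc_class_Cons_inj:
  assumes "distinct (p # v)" "p # v \<in> cyc_class (p # w)"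
  shows "v = w"
proof -
  obtain xs ys where xy: "p # w = xs @ ys" "p # v = ys @ xs"
    using assms(2) by (rule in_cyc_classE)
  show ?thesis
  proof (cases "xs = [] \<or> ys = []")
    case False
    then obtain a xs' b ys' where "xs = a # xs'" "ys = b # ys'"
      by (meson neq_Nil_conv)
    with xy have "p \<in> set xs" "p \<in> set ys" by simp_all
    moreover have "distinct (ys @ xs)" using assms(1) unfolding xy(2) .
    ultimately show ?thesis by auto
  next
    case True
    then have "ys @ xs = xs @ ys" by auto
    then have "p # v = p # w" by (simp only: xy)
    then show ?thesis by simp
  qed
qed

text \<open>A cut of the word also cuts its subword. Hence the representative of a cyclic shuffle
  can change while its two subwords stay in their classes.\<close>

lemma filter_in_cyc_class:
  assumes "v \<in> cyc_class w"
  shows "filter P v \<in> cyc_class (filter P w)"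
proof -
  obtain xs ys where "w = xs @ ys" "v = ys @ xs" using assms by (rule in_cyc_classE)
  then show ?thesis by (simp add: rotate_append_in_cyc_class)
qed

lemma cyc_class_eq_image_rotate:
  assumes "v \<noteq> []"
  shows "cyc_class v = (\<lambda>k. rotate k v) ` {..<length v}"
proof (intro equalityI subsetI)
  fix w assume "w \<in> cyc_class v"
  then obtain k where "w = rotate (k mod length v) v"
    unfolding cyc_class_def using rotate_conv_mod by blast
  then show "w \<in> (\<lambda>k. rotate k v) ` {..<length v}" using assms by simp
qed (auto simp: cyc_class_def)

lemma inj_on_rotate:
  assumes "distinct v" "v \<noteq> []"
  shows "inj_on (\<lambda>k. rotate k v) {..<length v}"
proof (rule inj_onI)
  fix j k assume jk: "j \<in> {..<length v}" "k \<in> {..<length v}" "rotate j v = rotate k v"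
  then have "v ! j = v ! k"
    using assms(2) by (metis hd_rotate_conv_nth lessThan_iff mod_less)
  then show "j = k" using jk assms by (simp add: nth_eq_iff_index_eq)
qed

section \<open>Representatives of cyclic shuffles that start with a fixed letter\<close>

text \<open>Rotate a representative until \<open>p\<close> is in front. Its subword in the letters
  of \<open>p # t\<close> is then a rotation starting with \<open>p\<close>, hence
  \<open>p # t\<close> itself, while the other subword may be any rotation of
  \<open>v\<close>.\<close>

lemma cyc_shuffles_Cons:
  assumes pt: "distinct (p # t)" and v: "distinct v" and disj: "set (p # t) \<inter> set v = {}"
  shows "cyc_shuffles (cyc_class (p # t)) (cyc_class v) =
    (\<lambda>w. cyc_class (p # w)) ` (\<Union>v'\<in>cyc_class v. shuffles t v')" (is "?L = ?R")
proof (intro equalityI subsetI)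
  fix C assume "C \<in> ?L"
  then obtain u' v' w where u': "u' \<in> cyc_class (p # t)" and v': "v' \<in> cyc_class v"
    and w: "w \<in> shuffles u' v'" and C: "C = cyc_class w"
    by (auto simp: cyc_shuffles_def)
  have sets: "set u' = set (p # t)" "set v' = set v"
    using u' v' by (auto simp: cyc_class_def)
  then obtain xs ys where xy: "w = xs @ p # ys"
    using set_shuffles[OF w] by (metis UnI1 list.set_intros(1) split_list)
  define w' where "w' = ys @ xs"
  have w': "p # w' \<in> cyc_class w"
    unfolding xy w'_def using rotate_append_in_cyc_class[of "p # ys" xs] by simp
  have disj': "set u' \<inter> set v' = {}" using sets disj by simp
  have u: "filter (\<lambda>x. x \<in> set u') w = u'" "filter (\<lambda>x. x \<notin> set u') w = v'"
    by (fact filter_shuffles_disjoint1[OF disj' w])+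
  have "filter (\<lambda>x. x \<in> set u') (p # w') \<in> cyc_class (p # t)"
    using filter_in_cyc_class[OF w', of "\<lambda>x. x \<in> set u'", unfolded u] u' by (rule cyc_class_trans)
  moreover have "p \<in> set u'" using sets by simp
  ultimately have pt': "p # filter (\<lambda>x. x \<in> set u') w' \<in> cyc_class (p # t)" by simp
  then have "distinct (p # filter (\<lambda>x. x \<in> set u') w')"
    using pt distinct_cyc_class by blast
  then have t: "filter (\<lambda>x. x \<in> set u') w' = t"
    using pt' by (rule cyc_class_Cons_inj)
  have "filter (\<lambda>x. x \<notin> set u') (p # w') \<in> cyc_class v"
    using filter_in_cyc_class[OF w', of "\<lambda>x. x \<notin> set u'", unfolded u] v' by (rule cyc_class_trans)
  then have "filter (\<lambda>x. x \<notin> set u') w' \<in> cyc_class v" using \<open>p \<in> set u'\<close> by simp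
  moreover have "w' \<in> shuffles t (filter (\<lambda>x. x \<notin> set u') w')"
    using partition_in_shuffles[of w' "\<lambda>x. x \<in> set u'"] t by simp
  moreover have "C = cyc_class (p # w')" using w' unfolding C cyc_class_eq_iff[symmetric] by (rule sym)
  ultimately show "C \<in> ?R" by blast
next
  fix C assume "C \<in> ?R"
  then obtain v' w where "v' \<in> cyc_class v" "w \<in> shuffles t v'" and C: "C = cyc_class (p # w)"
    by blast
  then have "p # w \<in> shuffles (p # t) v'" by (intro Cons_in_shuffles_leftI)
  with C \<open>v' \<in> cyc_class v\<close> show "C \<in> ?L"
    unfolding cyc_shuffles_def using cyc_class_self[of "p # t"] by blast
qed

text \<open>Nothing is counted twice: the representative \<open>p # w\<close> of a class is unique,
  and the subword of \<open>w\<close> in the letters of \<open>v\<close> recovers the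
  rotation.\<close>

lemma sum_cyc_shuffles_Cons:
  assumes pt: "distinct (p # t)" and v: "distinct v" "v \<noteq> []" and disj: "set (p # t) \<inter> set v = {}"
  shows "(\<Sum>C\<in>cyc_shuffles (cyc_class (p # t)) (cyc_class v). F C) =
    (\<Sum>k<length v. \<Sum>w\<in>shuffles t (rotate k v). F (cyc_class (p # w)))"
proof -
  have props: "distinct (p # w)" "filter (\<lambda>x. x \<in> set v) w = v'"
    if "v' \<in> cyc_class v" "w \<in> shuffles t v'" for v' w
  proof -
    have v': "set v' = set v" "distinct v'" using that v by (auto simp: cyc_class_def)
    then show "distinct (p # w)"
      using distinct_disjoint_shuffles[of t v' w] set_shuffles[OF that(2)] pt disj that by auto
    show "filter (\<lambda>x. x \<in> set v) w = v'"
      using filter_shuffles_disjoint2(1)[of t v' w] v' disj that by simp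
  qed
  have inj: "inj_on (\<lambda>w. cyc_class (p # w)) (\<Union>v'\<in>cyc_class v. shuffles t v')"
  proof (rule inj_onI)
    fix w w'
    assume w: "w \<in> (\<Union>v'\<in>cyc_class v. shuffles t v')" and eq: "cyc_class (p # w) = cyc_class (p # w')"
    show "w = w'"
    proof (rule cyc_class_Cons_inj)
      show "distinct (p # w)" using w props(1) by blast
      show "p # w \<in> cyc_class (p # w')" using eq by (simp add: cyc_class_eq_iff)
    qed
  qed
  have "(\<Sum>C\<in>cyc_shuffles (cyc_class (p # t)) (cyc_class v). F C) =
      (\<Sum>w\<in>(\<Union>v'\<in>cyc_class v. shuffles t v'). F (cyc_class (p # w)))"
    unfolding cyc_shuffles_Cons[OF pt v(1) disj] by (simp add: sum.reindex[OF inj])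
  also have "\<dots> = (\<Sum>v'\<in>cyc_class v. \<Sum>w\<in>shuffles t v'. F (cyc_class (p # w)))"
  proof (rule sum.UNION_disjoint)
    show "\<forall>v'\<in>cyc_class v. \<forall>v''\<in>cyc_class v. v' \<noteq> v'' \<longrightarrow> shuffles t v' \<inter> shuffles t v'' = {}"
      using props(2) by blast
  qed (simp_all add: cyc_class_eq_image_rotate[OF v(2)])
  also have "\<dots> = (\<Sum>k<length v. \<Sum>w\<in>shuffles t (rotate k v). F (cyc_class (p # w)))"
    unfolding cyc_class_eq_image_rotate[OF v(2)] by (simp add: sum.reindex[OF inj_on_rotate[OF v]])
  finally show ?thesis .
qed

section \<open>Descents after a maximal letter and the sum over rotations\<close>

text \<open>The step from \<open>p\<close> down to \<open>hd w\<close> is a descent, the step from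
  \<open>last w\<close> back up to \<open>p\<close> is not. A single letter \<open>p\<close> has no
  cyclic descent, so \<open>w\<close> must be nonempty.\<close>

lemma cdes_Cons_max:
  assumes "w \<noteq> []" "\<forall>x\<in>set w. x < p"
  shows "cdes (p # w) = Suc (des w)"
proof -
  have "last w < p" "hd w < p" using assms by simp_all
  then show ?thesis using assms(1) by (simp add: cdes_conv_des)
qed

lemma choose_descents_identity:
  fixes c n s :: nat
  assumes "c < n"
  shows "c * ((Suc s + n - c) choose n) + (n - c) * ((s + n - c) choose n)
    = ((s + n - c) choose (n - 1)) * Suc s"
proof -
  obtain e where n: "n = Suc (c + e)"
    using assms by (metis less_iff_Suc_add add_Suc_right)
  have N: "s + n - c = Suc (s + e)" "Suc s + n - c = Suc (Suc (s + e))" using n by auto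
  let ?a = "Suc (s + e) choose (c + e)" and ?b = "Suc (s + e) choose Suc (c + e)"
  have "Suc (c + e) * ?b + (c + e) * ?a = Suc (s + e) * ?a"
    \<comment> \<open>This is the absorption identity, with its left-hand coefficient expanded by
      Pascal's rule to \<open>?a + ?b\<close> and one \<open>?a\<close> cancelled.\<close>
    using Suc_times_binomial_eq[of "Suc (s + e)" "c + e"] by (simp add: algebra_simps)
  moreover have "Suc (Suc (s + e)) choose Suc (c + e) = ?a + ?b"
    by (rule binomial_Suc_Suc)
  ultimately show ?thesis
    unfolding N n by (simp add: algebra_simps del: binomial_Suc_Suc)
qed

text \<open>A rotation loses one linear descent exactly when its wrap-around pair is a descent,
  which happens \<open>cdes v\<close> times. The factor \<open>Suc s\<close> becomes the factor
  \<open>r\<close> of the final formula.\<close>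

lemma sum_rotate_choose:
  fixes v :: "int list"
  assumes "v \<noteq> []"
  shows "(\<Sum>k<length v. (s + length v - des (rotate k v)) choose length v)
    = ((s + length v - cdes v) choose (length v - 1)) * Suc s"
proof -
  let ?n = "length v"
  let ?b = "\<lambda>k. last (rotate k v) > hd (rotate k v)"
  have "cdes v < ?n" using assms by (rule cdes_less_length)
  have des: "cdes v = des (rotate k v) + of_bool (?b k)" for k
    using cdes_conv_des[of "rotate k v"] assms by (simp add: cdes_rotate)
  have count: "card {k \<in> {..<?n}. ?b k} = cdes v"
    using sum_rotate_last_gt_hd[OF assms] by (simp add: sum.If_cases of_bool_def Int_def)
  moreover have "card {k \<in> {..<?n}. \<not> ?b k} = ?n - cdes v"
  proof -
    have "{k \<in> {..<?n}. \<not> ?b k} = {..<?n} - {k \<in> {..<?n}. ?b k}" by blast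
    also have "card \<dots> = ?n - cdes v"
      unfolding count[symmetric] by (subst card_Diff_subset) auto
    finally show ?thesis .
  qed
  moreover have "(\<Sum>k<?n. (s + ?n - des (rotate k v)) choose ?n) =
      (\<Sum>k<?n. if ?b k then (Suc s + ?n - cdes v) choose ?n else (s + ?n - cdes v) choose ?n)"
  proof (rule sum.cong[OF refl])
    fix k
    show "(s + ?n - des (rotate k v)) choose ?n =
        (if ?b k then (Suc s + ?n - cdes v) choose ?n else (s + ?n - cdes v) choose ?n)"
      using des[of k] by simp
  qed
  ultimately show ?thesis
    using choose_descents_identity[OF \<open>cdes v < ?n\<close>]
    by (simp add: sum.If_cases Int_def lessThan_def Compl_eq conj_commute)
qed

text \<open>Stanley's theorem is applied to \<open>t\<close> and each rotation of \<open>v\<close>;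
  the descent after \<open>p\<close> contributes one factor \<open>fps_X\<close>.\<close>

lemma sum_cyc_shuffles_max_Cons:
  fixes p :: int
  assumes pt: "distinct (p # t)" and v: "distinct v" "v \<noteq> []" and disj: "set (p # t) \<inter> set v = {}"
    and max: "\<forall>x\<in>set t \<union> set v. x < p"
  defines "u \<equiv> p # t"
  shows "(\<Sum>C\<in>cyc_shuffles (cyc_class u) (cyc_class v). fps_X ^ cdes_class C :: 'b::comm_ring_1 fps)
    = (1 - fps_X) ^ (length u + length v) *
      Abs_fps (\<lambda>r. of_nat (((r + length u - cdes u - 1) choose (length u - 1))
                           * ((r + length v - cdes v - 1) choose (length v - 1)) * r))"
proof -
  let ?m = "length t" and ?n = "length v"
  let ?a = "\<lambda>s. (s + ?m - des t) choose ?m"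
  let ?b = "\<lambda>k s. (s + ?n - des (rotate k v)) choose ?n"
  have cdes_w: "cdes_class (cyc_class (p # w)) = Suc (des w)" if "w \<in> shuffles t (rotate k v)" for w k
  proof -
    have "set w = set t \<union> set v" using set_shuffles[OF that] by simp
    with max v(2) show ?thesis
      unfolding cdes_class_cyc_class by (intro cdes_Cons_max) auto
  qed
  \<comment> \<open>The removed letter and the removed descent cancel. If \<open>t = []\<close>,
    both binomial coefficients have lower index 0 and equal 1.\<close>
  have a: "?a s = (Suc s + length u - cdes u - 1) choose (length u - 1)" for s
  proof (cases "t = []")
    case False
    with max have "cdes u = Suc (des t)" unfolding u_def by (intro cdes_Cons_max) auto
    then show ?thesis by (simp add: u_def)
  qed (simp add: u_def)
  have inner: "(\<Sum>w\<in>shuffles t (rotate k v). fps_X ^ cdes_class (cyc_class (p # w))) =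
      fps_X * ((1 - fps_X) ^ Suc (?m + ?n) * Abs_fps (\<lambda>s. of_nat (?a s * ?b k s) :: 'b))" for k
  proof -
    have "(\<Sum>w\<in>shuffles t (rotate k v). fps_X ^ cdes_class (cyc_class (p # w))) =
        fps_X * (\<Sum>w\<in>shuffles t (rotate k v). fps_X ^ des w :: 'b fps)"
      unfolding sum_distrib_left by (intro sum.cong refl) (simp add: cdes_w)
    then show ?thesis
      using Stanley_shuffling[of t "rotate k v", where ?'b = 'b] pt v disj by simp
  qed
  have "(\<Sum>C\<in>cyc_shuffles (cyc_class u) (cyc_class v). fps_X ^ cdes_class C :: 'b fps) =
      (\<Sum>k<?n. fps_X * ((1 - fps_X) ^ Suc (?m + ?n) * Abs_fps (\<lambda>s. of_nat (?a s * ?b k s))))"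
    unfolding u_def sum_cyc_shuffles_Cons[OF pt v disj] inner ..
  also have "\<dots> = (1 - fps_X) ^ Suc (?m + ?n) * (fps_X * (\<Sum>k<?n. Abs_fps (\<lambda>s. of_nat (?a s * ?b k s))))"
    by (simp only: sum_distrib_left mult.left_commute)
  also have "(\<Sum>k<?n. Abs_fps (\<lambda>s. of_nat (?a s * ?b k s) :: 'b)) =
      Abs_fps (\<lambda>s. of_nat (?a s * (\<Sum>k<?n. ?b k s)))"
    by (simp add: fps_eq_iff fps_sum_nth sum_distrib_left)
  \<comment> \<open>Multiplication by \<open>fps_X\<close> substitutes \<open>r = Suc s\<close>; the
    missing coefficient at \<open>r = 0\<close> agrees with the factor \<open>r\<close>.\<close>
  also have "fps_X * \<dots> =
      Abs_fps (\<lambda>r. of_nat (((r + length u - cdes u - 1) choose (length u - 1))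
                           * ((r + ?n - cdes v - 1) choose (?n - 1)) * r))"
    unfolding fps_X_mult_Abs_fps fps_eq_iff a sum_rotate_choose[OF v(2)]
    by (auto simp: gr0_conv_Suc mult.assoc)
  finally show ?thesis by (simp add: u_def)
qed

section \<open>Symmetry in the two words and conclusion\<close>

lemma cyc_shuffles_commute: "cyc_shuffles U V = cyc_shuffles V (U :: 'a list set)"
proof -
  have "cyc_shuffles U V \<subseteq> cyc_shuffles V U" for U V :: "'a list set"
  proof
    fix C assume "C \<in> cyc_shuffles U V"
    then obtain u v w where uv: "u \<in> U" "v \<in> V" "w \<in> shuffles u v" "C = cyc_class w"
      unfolding cyc_shuffles_def by blast
    from uv(3) have "w \<in> shuffles v u" by (rule shuffles_commutes[THEN equalityD1, THEN subsetD])
    with uv show "C \<in> cyc_shuffles V U" unfolding cyc_shuffles_def by blast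
  qed
  then show ?thesis by blast
qed

text \<open>Class, length, letters and \<open>cdes\<close> are invariant under rotation, so
  \<open>u\<close> may be rotated to start with the maximum.\<close>

lemma sum_cyc_shuffles_Max_left:
  fixes u v :: "int list"
  assumes "distinct u" "distinct v" "u \<noteq> []" "v \<noteq> []" "set u \<inter> set v = {}"
    and "Max (set u \<union> set v) \<in> set u"
  shows "(\<Sum>C\<in>cyc_shuffles (cyc_class u) (cyc_class v). fps_X ^ cdes_class C :: 'b::comm_ring_1 fps)
    = (1 - fps_X) ^ (length u + length v) *
      Abs_fps (\<lambda>r. of_nat (((r + length u - cdes u - 1) choose (length u - 1))
                           * ((r + length v - cdes v - 1) choose (length v - 1)) * r))"
proof -
  define p where "p = Max (set u \<union> set v)"
  obtain xs ys where u: "u = xs @ p # ys"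
    using assms(6) split_list unfolding p_def by metis
  define t where "t = ys @ xs"
  have pt: "p # t \<in> cyc_class u"
    unfolding u t_def using rotate_append_in_cyc_class[of "p # ys" xs] by simp
  then have cls: "cyc_class (p # t) = cyc_class u" by (simp add: cyc_class_eq_iff)
  then have cdes: "cdes (p # t) = cdes u" by (metis cdes_class_cyc_class)
  have props: "set (p # t) = set u" "length (p # t) = length u" "distinct (p # t)"
    using assms(1) by (auto simp: u t_def)
  have "x < p" if "x \<in> set t \<union> set v" for x
  proof -
    have "x \<le> p" using that props(1) unfolding p_def by (intro Max_ge) auto
    moreover have "x \<noteq> p" using that props(1,3) assms(5) by auto
    ultimately show ?thesis by simp
  qed
  then show ?thesis
    using sum_cyc_shuffles_max_Cons[of p t v, where ?'b = 'b, unfolded props(1,2) cdes cls] props(3) assms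
    by blast
qed

theorem theorem5p10:
  fixes A B :: "int set" and m n :: nat and u v :: "int list"
  assumes "finite A" and "finite B"
    and "A \<noteq> {}" and "B \<noteq> {}"
    and "A \<inter> B = {}"
    and "card A = m" and "card B = n"
    and "u \<in> permutations_of_set A" and "v \<in> permutations_of_set B"
  shows "(\<Sum>C\<in>cyc_shuffles (cyc_class u) (cyc_class v). fps_X ^ cdes_class C :: int fps)
    = (1 - fps_X) ^ (m + n) *
      Abs_fps (\<lambda>r. of_nat (((r + m - cdes u - 1) choose (m - 1))
                           * ((r + n - cdes v - 1) choose (n - 1)) * r))"
proof -
  have u: "set u = A" "distinct u" "u \<noteq> []" "length u = m"
    and v: "set v = B" "distinct v" "v \<noteq> []" "length v = n"
    using assms by (auto simp: permutations_of_set_def distinct_card)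
  have "Max (A \<union> B) \<in> A \<union> B" using assms by (intro Max_in) auto
  then show ?thesis
  proof
    assume "Max (A \<union> B) \<in> A"
    then show ?thesis using sum_cyc_shuffles_Max_left[of u v, where ?'b = int] u v assms(5) by simp
  next
    \<comment> \<open>Here \<open>u\<close> and \<open>v\<close> exchange roles; both sides of the
      formula are symmetric in them.\<close>
    assume "Max (A \<union> B) \<in> B"
    then show ?thesis
      using sum_cyc_shuffles_Max_left[of v u, where ?'b = int] u v assms(5)
      by (simp add: cyc_shuffles_commute[of "cyc_class v"] Int_commute Un_commute add.commute mult.commute)
  qed
qed

end
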